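(* Let $B$ be the set of critical densities of proper minor-closed classes of graphs. For $x \geq 0$ let $\delta_B(x) = \inf\{\beta \in B : \beta > x\} - x$ (the gap above $x$ in $B$). Then $\delta_B(x) = O(x^{-2})$ as $x \to \infty$.
   Context: All graphs are finite and simple. For a graph $G$, $v(G)$ and $e(G)$ denote its numbers of vertices and edges, and its density is $\rho(G)=e(G)/v(G)$. A class of graphs is closed under isomorphism; it is proper if it is non-empty and does not contain all graphs; it is minor-closed if it contains every minor of each of its members (minors are simple graphs: loops and multiple edges created by contractions are discarded). For a class $\mathcal{A}$, $\beta_{\mathcal{A}} = \sup_{G\in\mathcal{A}} \rho(G)$ is its critical density, and $B=\{\beta_{\mathcal{A}} : \mathcal{A} \text{ a proper minor-closed class of graphs}\}$. *)

theory Defs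
  imports Complex_Main "HOL-Library.Ramsey" "HOL-Library.Landau_Symbols"
begin

type_synonym 'a ugraph = "'a set \<times> 'a set set"

abbreviation verts :: "'a ugraph \<Rightarrow> 'a set" where
  "verts G \<equiv> fst G"

abbreviation edges :: "'a ugraph \<Rightarrow> 'a set set" where
  "edges G \<equiv> snd G"

text \<open>Graphs have at least one vertex, so that the density is always defined.\<close>

definition simple_graph :: "'a ugraph \<Rightarrow> bool" where
  "simple_graph G \<longleftrightarrow> finite (verts G) \<and> verts G \<noteq> {} \<and> edges G \<subseteq> nsets (verts G) 2"

definition density :: "'a ugraph \<Rightarrow> real" where
  "density G = real (card (edges G)) / real (card (verts G))"

definition isomorphic :: "'a ugraph \<Rightarrow> 'b ugraph \<Rightarrow> bool" where
  "isomorphic G H \<longleftrightarrow>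
     (\<exists>f. bij_betw f (verts G) (verts H) \<and> edges H = (\<lambda>e. f ` e) ` edges G)"

definition delete_vertex :: "'a ugraph \<Rightarrow> 'a \<Rightarrow> 'a ugraph" where
  "delete_vertex G v = (verts G - {v}, {e \<in> edges G. v \<notin> e})"

definition delete_edge :: "'a ugraph \<Rightarrow> 'a set \<Rightarrow> 'a ugraph" where
  "delete_edge G e = (verts G, edges G - {e})"

text \<open>The vertex \<open>v\<close> is merged into \<open>u\<close>. The contracted edge becomes the loop \<open>{u}\<close>,
  which the cardinality condition removes; parallel edges coincide as sets.\<close>

definition contract_edge :: "'a ugraph \<Rightarrow> 'a \<Rightarrow> 'a \<Rightarrow> 'a ugraph" where
  "contract_edge G u v =
     (verts G - {v}, {e \<in> (\<lambda>e. (id(v := u)) ` e) ` edges G. card e = 2})"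

inductive minor_step :: "'a ugraph \<Rightarrow> 'a ugraph \<Rightarrow> bool" for G where
  "v \<in> verts G \<Longrightarrow> verts G \<noteq> {v} \<Longrightarrow> minor_step G (delete_vertex G v)"
| "e \<in> edges G \<Longrightarrow> minor_step G (delete_edge G e)"
| "{u, v} \<in> edges G \<Longrightarrow> minor_step G (contract_edge G u v)"

definition is_minor :: "'b ugraph \<Rightarrow> 'a ugraph \<Rightarrow> bool" where
  "is_minor H G \<longleftrightarrow> (\<exists>H'. minor_step\<^sup>*\<^sup>* G H' \<and> isomorphic H' H)"

text \<open>Every finite graph has an isomorphic copy with vertices in \<open>nat\<close>, so
  isomorphism-closed classes of finite graphs are represented by sets of such copies.\<close>

definition graph_class :: "nat ugraph set \<Rightarrow> bool" where
  "graph_class \<A> \<longleftrightarrow>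
     (\<forall>G\<in>\<A>. simple_graph G) \<and> (\<forall>G\<in>\<A>. \<forall>H. isomorphic G H \<longrightarrow> H \<in> \<A>)"

definition proper_class :: "nat ugraph set \<Rightarrow> bool" where
  "proper_class \<A> \<longleftrightarrow> graph_class \<A> \<and> \<A> \<noteq> {} \<and> (\<exists>G. simple_graph G \<and> G \<notin> \<A>)"

definition minor_closed :: "nat ugraph set \<Rightarrow> bool" where
  "minor_closed \<A> \<longleftrightarrow> (\<forall>G\<in>\<A>. \<forall>H. is_minor H G \<longrightarrow> H \<in> \<A>)"

text \<open>For proper minor-closed classes the supremum is over a nonempty set, bounded by
  Mader's theorem.\<close>

definition critical_density :: "nat ugraph set \<Rightarrow> real" where
  "critical_density \<A> = (SUP G\<in>\<A>. density G)"

definition critical_densities :: "real set" where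
  "critical_densities = {critical_density \<A> | \<A>. proper_class \<A> \<and> minor_closed \<A>}"

definition density_gap :: "real \<Rightarrow> real" where
  "density_gap x = Inf {\<beta> \<in> critical_densities. \<beta> > x} - x"

end

theory Submission imports Defs begin

text \<open>Let \<open>H\<close> have \<open>t + 1\<close> vertices and \<open>k \<ge> t\<^sup>2 / 2\<close> edges, and glue \<open>a\<close> copies of \<open>H\<close> at a
  common vertex. Every minor with \<open>m\<close> vertices of the resulting windmill has at most
  \<open>(k / t) (m - 1)\<close> edges: a blade that has lost a vertex is too small to be denser than that.
  As \<open>m \<le> a t + 1\<close>, the windmill itself is the densest of its minors, so
  \<open>a k / (a t + 1)\<close> is a critical density.

  Given \<open>x\<close>, take \<open>t = \<lfloor>2 x\<rfloor>\<close> and the least \<open>k > x t\<close>. Then \<open>\<delta> = k - x t\<close> lies in \<open>(0, 1]\<close>, and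
  \<open>a k / (a t + 1) - x = (a \<delta> - x) / (a t + 1)\<close>. For the least \<open>a\<close> with \<open>a \<delta> > x\<close> this is
  positive and at most \<open>\<delta> / (a t + 1)\<close>, which is \<open>O(x\<^sup>-\<^sup>2)\<close> since both \<open>a\<close> and \<open>t\<close> are at least
  of order \<open>x\<close>.\<close>

section \<open>Windmill labellings and their closure under minors\<close>

text \<open>The label \<open>0\<close> marks the hub, which may have been deleted; a label \<open>i > 0\<close> marks the
  vertices of the \<open>i\<close>-th blade other than the hub.\<close>

definition blade_labelling :: "nat \<Rightarrow> nat \<Rightarrow> 'a ugraph \<Rightarrow> ('a \<Rightarrow> nat) \<Rightarrow> bool" where
  "blade_labelling t k G f \<longleftrightarrow> card {x \<in> verts G. f x = 0} \<le> 1 \<and>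
     (\<forall>i>0. card {x \<in> verts G. f x = i} \<le> t) \<and>
     (\<forall>i>0. card {e \<in> edges G. f ` e \<subseteq> {0, i}} \<le> k) \<and>
     (\<forall>e \<in> edges G. \<exists>i>0. f ` e \<subseteq> {0, i})"

text \<open>The class is described by labellings instead of as the minors of one fixed graph. It is
  larger: blades may carry different edge sets, and their number is limited only through the vertex
  bound \<open>n\<close>. Closure under minors can then be checked one step at a time.\<close>

definition windmill :: "nat \<Rightarrow> nat \<Rightarrow> nat \<Rightarrow> 'a ugraph \<Rightarrow> bool" where
  "windmill t k n G \<longleftrightarrow>
     simple_graph G \<and> card (verts G) \<le> n \<and> (\<exists>f. blade_labelling t k G f)"

lemma blade_labellingD:
  assumes "blade_labelling t k G f"
  shows "card {x \<in> verts G. f x = 0} \<le> 1"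
    and "\<And>i. i > 0 \<Longrightarrow> card {x \<in> verts G. f x = i} \<le> t"
    and "\<And>i. i > 0 \<Longrightarrow> card {e \<in> edges G. f ` e \<subseteq> {0, i}} \<le> k"
    and "\<And>e. e \<in> edges G \<Longrightarrow> \<exists>i>0. f ` e \<subseteq> {0, i}"
  using assms unfolding blade_labelling_def by simp_all

lemma finite_edges: "simple_graph G \<Longrightarrow> finite (edges G)"
  unfolding simple_graph_def by (meson finite_imp_finite_nsets finite_subset)

text \<open>An edge has two ends and at most one vertex is labelled \<open>0\<close>. So every edge
  has an end with a positive label, and that label determines its blade.\<close>

lemma edge_not_in_hub:
  assumes "e \<in> nsets V 2" "finite V" "card {x \<in> V. f x = (0::nat)} \<le> 1"
  obtains x where "x \<in> e" "x \<in> V" "f x \<noteq> 0"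
proof -
  have "\<not> e \<subseteq> {x \<in> V. f x = 0}"
  proof
    assume "e \<subseteq> {x \<in> V. f x = 0}"
    then have "card e \<le> card {x \<in> V. f x = 0}"
      using assms(2) by (intro card_mono) auto
    then show False using assms by (auto simp: nsets_def)
  qed
  then show thesis using assms(1) that by (auto simp: nsets_def)
qed

text \<open>Vertex and edge deletions, contractions and isomorphisms are all instances of such a map \<open>g\<close>.\<close>

lemma windmill_image:
  fixes G :: "'a ugraph" and H :: "'b ugraph" and g :: "'a \<Rightarrow> 'b"
  assumes G: "simple_graph G" "card (verts G) \<le> n"
    and f: "blade_labelling t k G f"
    and H: "simple_graph H" "verts H \<subseteq> g ` verts G" "edges H \<subseteq> (\<lambda>e. g ` e) ` edges G"
    and compat: "\<And>x y. x \<in> verts G \<Longrightarrow> y \<in> verts G \<Longrightarrow> g x = g y \<Longrightarrow>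
      f x = 0 \<or> f y = 0 \<or> f x = f y"
  shows "windmill t k n H"
proof -
  note hub = blade_labellingD(1)[OF f] and blade = blade_labellingD(2,3)[OF f]
    and edge = blade_labellingD(4)[OF f]
  \<comment> \<open>By \<open>compat\<close>, the labels on a fibre of \<open>g\<close> include at
    most one positive value. Their minimum is thus \<open>0\<close> if the fibre meets the hub, and
    the common label otherwise.\<close>
  define f' where "f' y = Inf (f ` {x \<in> verts G. g x = y})" for y
  have fin: "finite (verts G)" and sub: "\<And>e. e \<in> edges G \<Longrightarrow> e \<subseteq> verts G"
    using G(1) by (auto simp: simple_graph_def nsets_def)
  have finE: "finite (edges G)" by (rule finite_edges[OF G(1)])
  have f'_le: "f' (g x) \<le> f x" if "x \<in> verts G" for x
    unfolding f'_def by (rule cInf_lower) (use that in auto)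
  have f'_attained: "\<exists>x' \<in> verts G. g x' = g x \<and> f' (g x) = f x'" if "x \<in> verts G" for x
  proof -
    have "f ` {x' \<in> verts G. g x' = g x} \<noteq> {}" using that by auto
    from Inf_nat_def1[OF this] show ?thesis unfolding f'_def by auto
  qed
  have f'_cases: "f' (g x) = 0 \<or> f' (g x) = f x" if x: "x \<in> verts G" for x
    using f'_attained[OF x] f'_le[OF x] compat[OF x] by fastforce
  have hub': "{y \<in> verts H. f' y = 0} \<subseteq> g ` {x \<in> verts G. f x = 0}"
  proof
    fix y assume y: "y \<in> {y \<in> verts H. f' y = 0}"
    then obtain x where "x \<in> verts G" "y = g x" using H(2) by auto
    then obtain x' where "x' \<in> verts G" "g x' = y" "f' y = f x'" using f'_attained by metis
    then show "y \<in> g ` {x \<in> verts G. f x = 0}" using y by force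
  qed
  have blade': "{y \<in> verts H. f' y = i} \<subseteq> g ` {x \<in> verts G. f x = i}" if "i > 0" for i
  proof
    fix y assume y: "y \<in> {y \<in> verts H. f' y = i}"
    then obtain x where x: "x \<in> verts G" "y = g x" using H(2) by auto
    then have "f x = i" using y that f'_cases[OF x(1)] by auto
    then show "y \<in> g ` {x \<in> verts G. f x = i}" using x by auto
  qed
  have card_hub': "card {y \<in> verts H. f' y = 0} \<le> 1"
    using surj_card_le[OF _ hub'] fin hub by force
  have edge_image: "f' ` g ` e \<subseteq> {0, i}" if "e \<in> edges G" "f ` e \<subseteq> {0, i}" for e i
  proof
    fix l assume "l \<in> f' ` g ` e"
    then obtain x where "x \<in> e" "l = f' (g x)" by auto
    then show "l \<in> {0, i}" using f'_cases[of x] sub[OF that(1)] that(2) by auto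
  qed
  \<comment> \<open>An edge of \<open>H\<close> in blade \<open>i\<close> comes from an edge of
    \<open>G\<close> in some blade \<open>j\<close>. Its end off the hub keeps label
    \<open>j\<close>, hence \<open>i = j\<close>, and blade \<open>i\<close> gains no edges.\<close>
  have edges': "{e \<in> edges H. f' ` e \<subseteq> {0, i}} \<subseteq> (\<lambda>e. g ` e) ` {e \<in> edges G. f ` e \<subseteq> {0, i}}"
    if i: "i > 0" for i
  proof
    fix d assume d: "d \<in> {e \<in> edges H. f' ` e \<subseteq> {0, i}}"
    then obtain e where e: "e \<in> edges G" "d = g ` e" using H(3) by auto
    obtain j where j: "j > 0" "f ` e \<subseteq> {0, j}" using edge[OF e(1)] by auto
    have "d \<in> nsets (verts H) 2" "finite (verts H)" using d H(1) by (auto simp: simple_graph_def)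
    then obtain y where y: "y \<in> d" "f' y \<noteq> 0" using edge_not_in_hub[OF _ _ card_hub'] by metis
    then obtain x where "x \<in> e" "y = g x" using e by auto
    then have "f' y \<in> {0, j}" by (intro subsetD[OF edge_image[OF e(1) j(2)]]) simp
    then have "f' y = j" using y by simp
    moreover have "f' y = i" using d y by auto
    ultimately show "d \<in> (\<lambda>e. g ` e) ` {e \<in> edges G. f ` e \<subseteq> {0, i}}"
      using e j by auto
  qed
  have "card {y \<in> verts H. f' y = i} \<le> t" if "i > 0" for i
    using surj_card_le[OF _ blade'[OF that]] fin blade(1)[OF that] by force
  moreover have "card {e \<in> edges H. f' ` e \<subseteq> {0, i}} \<le> k" if "i > 0" for i
    using surj_card_le[OF _ edges'[OF that]] finE blade(2)[OF that] by force
  moreover have "\<exists>i>0. f' ` e \<subseteq> {0, i}" if e: "e \<in> edges H" for e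
  proof -
    obtain d where d: "d \<in> edges G" "e = g ` d" using e H(3) by auto
    then obtain i where "i > 0" "f ` d \<subseteq> {0, i}" using edge by metis
    then show ?thesis using edge_image[OF d(1)] d(2) by metis
  qed
  moreover have "card (verts H) \<le> n"
    using surj_card_le[OF fin H(2)] G(2) by simp
  ultimately show ?thesis
    unfolding windmill_def blade_labelling_def using H(1) card_hub'
    by (intro conjI exI[of _ f']) simp_all
qed

lemma windmill_isomorphic:
  assumes "windmill t k n G" "isomorphic G H"
  shows "windmill t k n H"
proof -
  obtain h where h: "bij_betw h (verts G) (verts H)" "edges H = (\<lambda>e. h ` e) ` edges G"
    using assms(2) unfolding isomorphic_def by auto
  have inj: "inj_on h (verts G)" and im: "h ` verts G = verts H"
    using h(1) by (auto simp: bij_betw_def)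
  have "simple_graph G" using assms(1) by (simp add: windmill_def)
  have "h ` e \<in> nsets (verts H) 2" if "e \<in> edges G" for e
  proof -
    have e: "e \<subseteq> verts G" "finite e" "card e = 2"
      using \<open>simple_graph G\<close> that by (auto simp: simple_graph_def nsets_def)
    then have "card (h ` e) = 2" by (metis card_image inj inj_on_subset)
    then show ?thesis using e im by (auto simp: nsets_def)
  qed
  then have "simple_graph H"
    using \<open>simple_graph G\<close> h(2) by (auto simp: simple_graph_def simp flip: im)
  moreover have "card (verts G) \<le> n" using assms(1) by (simp add: windmill_def)
  moreover obtain f where f: "blade_labelling t k G f"
    using assms(1) by (auto simp: windmill_def)
  ultimately show ?thesis
    using \<open>simple_graph G\<close> h im inj
    by (intro windmill_image[of G n t k f H h] f) (auto dest: inj_onD)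
qed

lemma windmill_minor_step:
  assumes "windmill t k n G" "minor_step G H"
  shows "windmill t k n H"
proof -
  have G: "simple_graph G" "card (verts G) \<le> n" using assms(1) by (auto simp: windmill_def)
  obtain f where f: "blade_labelling t k G f"
    using assms(1) by (auto simp: windmill_def)
  show ?thesis using assms(2)
  proof cases
    case (1 v)
    then have "simple_graph H"
      using G(1) by (auto simp: simple_graph_def delete_vertex_def nsets_def)
    then show ?thesis
      by (intro windmill_image[of G n t k f H id] G f) (auto simp: 1 delete_vertex_def)
  next
    case (2 e)
    then have "simple_graph H"
      using G(1) by (auto simp: simple_graph_def delete_edge_def)
    then show ?thesis
      by (intro windmill_image[of G n t k f H id] G f) (auto simp: 2 delete_edge_def)
  next
    case (3 u v)
    have uv: "u \<in> verts G" "v \<in> verts G" "u \<noteq> v"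
      using 3(2) G(1) by (auto simp: simple_graph_def nsets_def card_insert_if split: if_splits)
    let ?g = "id(v := u)"
    have im: "?g ` verts G = verts H" using uv by (auto simp: 3 contract_edge_def)
    have "edges H \<subseteq> nsets (verts H) 2"
    proof
      fix d assume "d \<in> edges H"
      then obtain e where e: "e \<in> edges G" "d = ?g ` e" "card d = 2"
        by (auto simp: 3 contract_edge_def)
      then have "e \<subseteq> verts G" using G(1) by (auto simp: simple_graph_def nsets_def)
      then have "d \<subseteq> verts H" unfolding e(2) im[symmetric] by (rule image_mono)
      then show "d \<in> nsets (verts H) 2" using e(3) card_ge_0_finite[of d] by (auto simp: nsets_def)
    qed
    moreover have "finite (verts H)" "verts H \<noteq> {}"
      using G(1) by (auto simp: simple_graph_def simp flip: im)
    ultimately have "simple_graph H" by (simp add: simple_graph_def)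
    \<comment> \<open>The contracted edge lies within one blade and the hub, so merging its ends
      never identifies vertices of two different blades.\<close>
    moreover have "f u = 0 \<or> f v = 0 \<or> f u = f v" using blade_labellingD(4)[OF f 3(2)] by auto
    moreover have "edges H \<subseteq> (\<lambda>e. ?g ` e) ` edges G" by (auto simp: 3 contract_edge_def)
    ultimately show ?thesis
      by (intro windmill_image[of G n t k f H ?g] G f) (simp_all only: im, auto split: if_splits)
  qed
qed

lemma windmill_minor:
  assumes "windmill t k n G" "is_minor H G"
  shows "windmill t k n H"
proof -
  obtain H' where H': "minor_step\<^sup>*\<^sup>* G H'" "isomorphic H' H"
    using assms(2) unfolding is_minor_def by auto
  from H'(1) assms(1) have "windmill t k n H'"
    by (induction rule: rtranclp_induct) (auto intro: windmill_minor_step)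
  then show ?thesis using H'(2) by (rule windmill_isomorphic)
qed

section \<open>Edge and density bounds\<close>

lemma two_times_choose_two: "2 * (Suc n choose 2) = Suc n * n"
  by (induction n) (simp_all add: numeral_2_eq_2)

lemma card_nsets_2: "2 * real (card (nsets A 2)) = real (card A) * (real (card A) - 1)"
proof (cases "card A")
  case (Suc n)
  have "2 * real (Suc n choose 2) = real (Suc n * n)"
    by (metis two_times_choose_two of_nat_mult of_nat_numeral)
  then show ?thesis by (simp add: Suc algebra_simps)
qed simp

text \<open>Edges are charged blade by blade: a blade with \<open>u\<close> vertices off the hub has
  at most \<open>k / t\<close> times \<open>u + card Z - 1\<close> edges, where \<open>Z\<close> is
  the hub class. These quantities are then summed.\<close>

lemma windmill_card_edges:
  assumes W: "windmill t k n G" and t: "t > 0" "t * t \<le> 2 * k"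
  shows "real (card (edges G)) \<le> real k / real t * (real (card (verts G)) - 1)"
proof -
  obtain f where "blade_labelling t k G f" using W by (auto simp: windmill_def)
  note f = blade_labellingD[OF this]
  have fin: "finite (verts G)" "verts G \<noteq> {}" and E: "edges G \<subseteq> nsets (verts G) 2"
    using W by (auto simp: windmill_def simple_graph_def)
  have finE: "finite (edges G)" using W by (auto simp: windmill_def intro: finite_edges)
  define Z where "Z = {x \<in> verts G. f x = 0}"
  define U where "U i = {x \<in> verts G. f x = i}" for i
  define D where "D i = {e \<in> edges G. f ` e \<subseteq> {0, i}}" for i
  define I where "I = f ` verts G - {0}"
  define r where "r = real k / real t"
  have r: "real t \<le> 2 * r" "r * real t = real k" "r \<ge> 0"
  proof -
    have "real t * real t \<le> 2 * real k" using t(2) by (metis of_nat_le_iff of_nat_mult of_nat_numeral)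
    then show "real t \<le> 2 * r" using t(1) by (simp add: r_def field_simps)
  qed (use t in \<open>auto simp: r_def\<close>)
  have finI: "finite I" using fin by (simp add: I_def)
  have vG: "verts G = Z \<union> (\<Union>i\<in>I. U i)" by (auto simp: Z_def U_def I_def)
  have "card (verts G) = card Z + card (\<Union>i\<in>I. U i)"
    by (subst vG, rule card_Un_disjoint) (use fin finI in \<open>auto simp: Z_def U_def I_def\<close>)
  also have "card (\<Union>i\<in>I. U i) = (\<Sum>i\<in>I. card (U i))"
    by (rule card_UN_disjoint) (use fin finI in \<open>auto simp: U_def\<close>)
  finally have cardV: "real (card (verts G)) = real (card Z) + (\<Sum>i\<in>I. real (card (U i)))" by simp
  have "edges G \<subseteq> (\<Union>i\<in>I. D i)"
  proof
    fix e assume e: "e \<in> edges G"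
    obtain i where i: "i > 0" "f ` e \<subseteq> {0, i}" using f(4)[OF e] by auto
    obtain x where "x \<in> e" "x \<in> verts G" "f x \<noteq> 0"
      using edge_not_in_hub[OF _ fin(1) f(1)] e E by blast
    moreover from this have "f x = i" using i by auto
    ultimately have "i \<in> I" "e \<in> D i" using i e by (auto simp: I_def D_def)
    then show "e \<in> (\<Union>i\<in>I. D i)" by blast
  qed
  then have "card (edges G) \<le> card (\<Union>i\<in>I. D i)"
    using finI finE by (intro card_mono) (auto simp: D_def)
  also have "\<dots> \<le> (\<Sum>i\<in>I. card (D i))" by (rule card_UN_le[OF finI])
  finally have cardE: "real (card (edges G)) \<le> (\<Sum>i\<in>I. real (card (D i)))"
    by (metis of_nat_le_iff of_nat_sum)
  \<comment> \<open>A full blade with its hub is bounded by its budget \<open>k = r * t\<close>. Any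
    other blade spans, with \<open>Z\<close>, only \<open>m \<le> t \<le> 2 * r\<close> vertices, so
    even a complete graph there has \<open>m * (m - 1) / 2 \<le> r * (m - 1)\<close> edges.\<close>
  have bound: "real (card (D i)) \<le> r * (real (card (U i)) + real (card Z) - 1)" if i: "i \<in> I" for i
  proof (cases "card Z = 1 \<and> card (U i) = t")
    case True
    then show ?thesis using f(3)[of i] i r by (simp add: D_def I_def)
  next
    case False
    have i0: "i > 0" using i by (simp add: I_def)
    have "U i \<noteq> {}" using i by (auto simp: U_def I_def)
    then have U: "card (U i) > 0" using fin by (simp add: U_def card_gt_0_iff)
    have "D i \<subseteq> nsets (U i \<union> Z) 2"
    proof
      fix e assume "e \<in> D i"
      then show "e \<in> nsets (U i \<union> Z) 2"
        using E by (fastforce simp: D_def nsets_def U_def Z_def)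
    qed
    then have "card (D i) \<le> card (nsets (U i \<union> Z) 2)"
      using fin by (intro card_mono finite_imp_finite_nsets) (auto simp: U_def Z_def)
    moreover define m where "m = card (U i \<union> Z)"
    ultimately have "2 * real (card (D i)) \<le> real m * (real m - 1)"
      using card_nsets_2[of "U i \<union> Z"] by simp
    have m: "m = card (U i) + card Z"
      unfolding m_def by (rule card_Un_disjoint) (use fin i0 in \<open>auto simp: U_def Z_def\<close>)
    have "m \<le> t" using False f(1) f(2)[OF i0] unfolding m by (auto simp: U_def Z_def)
    then have "real m \<le> 2 * r" using r(1) by linarith
    moreover have "real m - 1 \<ge> 0" using U m by simp
    ultimately have "real m * (real m - 1) \<le> 2 * r * (real m - 1)"
      by (intro mult_right_mono)
    with \<open>2 * real (card (D i)) \<le> real m * (real m - 1)\<close> show ?thesis by (simp add: m)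
  qed
  \<comment> \<open>With a hub this is an equality. Without one every blade loses \<open>1\<close>,
    and at least one blade exists because \<open>G\<close> has a vertex.\<close>
  have "(\<Sum>i\<in>I. real (card (U i)) + real (card Z) - 1) \<le> real (card (verts G)) - 1"
  proof (cases "card Z = 1")
    case True
    then show ?thesis by (simp add: cardV)
  next
    case False
    then have "card Z = 0" using f(1) by (simp add: Z_def)
    then have "Z = {}" using fin by (simp add: Z_def)
    then have "I \<noteq> {}" using vG fin by auto
    then have "card I \<ge> 1" using finI by (simp add: Suc_leI card_gt_0_iff)
    then show ?thesis using \<open>Z = {}\<close> by (simp add: cardV sum_subtractf)
  qed
  then have "r * (\<Sum>i\<in>I. real (card (U i)) + real (card Z) - 1) \<le> r * (real (card (verts G)) - 1)"
    using r(3) by (rule mult_left_mono)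
  moreover have "real (card (edges G)) \<le> r * (\<Sum>i\<in>I. real (card (U i)) + real (card Z) - 1)"
    unfolding sum_distrib_left by (intro order_trans[OF cardE] sum_mono bound)
  ultimately show ?thesis by (simp add: r_def)
qed

text \<open>The edge bound divided by the number \<open>v\<close> of vertices is
  \<open>(k / t) * (1 - 1 / v)\<close>, which increases with \<open>v\<close> and is therefore
  largest at \<open>v = a * t + 1\<close>.\<close>

lemma windmill_density_le:
  assumes W: "windmill t k (a * t + 1) G" and t: "t > 0" "t * t \<le> 2 * k"
  shows "density G \<le> real (a * k) / real (a * t + 1)"
proof -
  define v where "v = real (card (verts G))"
  have "card (verts G) > 0" "card (verts G) \<le> a * t + 1"
    using W by (auto simp: windmill_def simple_graph_def card_gt_0_iff)
  then have v: "v > 0" "v \<le> real (a * t + 1)" unfolding v_def by linarith+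
  have "density G \<le> real k / real t * (v - 1) / v"
    unfolding density_def v_def
    by (intro divide_right_mono windmill_card_edges[OF W t]) simp
  also have "\<dots> = real k / real t * (1 - 1 / v)" using v(1) by (simp add: field_simps)
  also have "\<dots> \<le> real k / real t * (1 - 1 / real (a * t + 1))"
    using v by (intro mult_left_mono diff_left_mono divide_left_mono) auto
  also have "1 - 1 / real (a * t + 1) = real t * (real a / real (a * t + 1))"
  proof -
    have "1 + real a * real t > 0" by (simp add: add_pos_nonneg)
    then show ?thesis by (simp add: field_simps)
  qed
  finally show ?thesis using t(1) by (simp add: mult_ac)
qed

section \<open>Construction of an extremal windmill\<close>

lemma windmill_exists:
  assumes t: "t > 0" and k: "k \<le> (t + 1) choose 2"
  obtains G :: "nat ugraph" where "windmill t k (a * t + 1) G"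
    "density G = real (a * k) / real (a * t + 1)"
proof -
  define V where "V = {..a * t}"
  \<comment> \<open>This is \<open>x / t\<close> rounded up: \<open>0\<close> is the hub, and blade
    \<open>i > 0\<close> consists of the \<open>t\<close> numbers from
    \<open>(i - 1) * t + 1\<close> to \<open>i * t\<close>.\<close>
  define f where "f x = (x + t - 1) div t" for x :: nat
  define U where "U i = {x \<in> V. f x = i}" for i
  have f0: "f x = 0 \<longleftrightarrow> x = 0" for x
    using t by (auto simp: f_def div_eq_0_iff)
  have fS: "f x = Suc j \<longleftrightarrow> j * t < x \<and> x \<le> Suc j * t" for x j
  proof -
    have "f x = Suc j \<longleftrightarrow> Suc j * t \<le> x + t - 1 \<and> x + t - 1 < Suc (Suc j) * t"
      unfolding f_def using t by (metis div_nat_eqI div_times_less_eq_dividend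
          dividend_less_div_times mult.commute mult_Suc)
    then show ?thesis using t by auto
  qed
  have U_le: "card (U i) \<le> t" if i: "i > 0" for i
  proof -
    obtain j where j: "i = Suc j" using i by (cases i) auto
    have "U i \<subseteq> {j * t<..Suc j * t}" by (auto simp: U_def j fS)
    then have "card (U i) \<le> card {j * t<..Suc j * t}" by (rule card_mono[rotated]) simp
    then show ?thesis by simp
  qed
  have U_eq: "card (U i) = t" if i: "i \<in> {1..a}" for i
  proof -
    obtain j where j: "i = Suc j" using i by (cases i) auto
    have "Suc j * t \<le> a * t" using i j by (intro mult_le_mono1) auto
    then have "U i = {j * t<..Suc j * t}" by (auto simp: U_def V_def j fS)
    then show ?thesis by simp
  qed
  have finU: "finite (U i)" for i by (simp add: U_def V_def)
  \<comment> \<open>Any \<open>k\<close> pairs inside a blade with its hub will do, since only the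
    number of edges enters the density.\<close>
  have "\<exists>D. D \<subseteq> nsets (insert 0 (U i)) 2 \<and> card D = k" if i: "i \<in> {1..a}" for i
  proof -
    have "0 \<notin> U i" using i f0[of 0] by (auto simp: U_def)
    then have "card (nsets (insert 0 (U i)) 2) = (t + 1) choose 2"
      using U_eq[OF i] finU by (simp add: card_nsets)
    then show ?thesis using k obtain_subset_with_card_n by metis
  qed
  then obtain D where D: "\<And>i. i \<in> {1..a} \<Longrightarrow> D i \<subseteq> nsets (insert 0 (U i)) 2 \<and> card (D i) = k"
    by metis
  define G where "G = (V, \<Union>i\<in>{1..a}. D i)"
  have hub: "{x \<in> V. f x = 0} = {0}" by (auto simp: f0 V_def)
  have E: "(\<Union>i\<in>{1..a}. D i) \<subseteq> nsets V 2"
  proof -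
    have "D i \<subseteq> nsets V 2" if "i \<in> {1..a}" for i
    proof -
      have "nsets (insert 0 (U i)) 2 \<subseteq> nsets V 2"
        by (rule nsets_mono) (auto simp: U_def V_def)
      then show ?thesis using D[OF that] by blast
    qed
    then show ?thesis by blast
  qed
  then have G: "simple_graph G" by (auto simp: simple_graph_def G_def V_def)
  have label: "f ` e \<subseteq> {0, i}" if "i \<in> {1..a}" "e \<in> D i" for i e
    using D[OF that(1)] that(2) f0[of 0] by (fastforce simp: nsets_def U_def)
  \<comment> \<open>This serves twice: it identifies the edges of blade \<open>i\<close> with
    \<open>D i\<close>, and it makes the sets \<open>D i\<close> disjoint, so that there are
    \<open>a * k\<close> edges in total.\<close>
  have unique: "i = j" if "i \<in> {1..a}" "e \<in> D i" "f ` e \<subseteq> {0, j}" for i j e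
  proof -
    have "e \<in> nsets V 2" using that E by blast
    then obtain x where "x \<in> e" "f x \<noteq> 0"
      by (rule edge_not_in_hub[of e V f]) (auto simp: hub, auto simp: V_def)
    then show ?thesis
      using subsetD[OF label[OF that(1,2)] imageI] subsetD[OF that(3) imageI] by fastforce
  qed
  have "card {e \<in> edges G. f ` e \<subseteq> {0, i}} \<le> k" for i
  proof (cases "i \<in> {1..a}")
    case True
    have "{e \<in> edges G. f ` e \<subseteq> {0, i}} = D i"
    proof
      show "{e \<in> edges G. f ` e \<subseteq> {0, i}} \<subseteq> D i"
        using unique by (fastforce simp: G_def)
      show "D i \<subseteq> {e \<in> edges G. f ` e \<subseteq> {0, i}}"
        using True by (intro subsetI CollectI conjI label[OF True]) (auto simp: G_def)
    qed
    then show ?thesis using D[OF True] by simp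
  next
    case False
    then have "{e \<in> edges G. f ` e \<subseteq> {0, i}} = {}"
      using unique by (fastforce simp: G_def)
    then show ?thesis by (metis card.empty le0)
  qed
  moreover have "\<exists>i>0. f ` e \<subseteq> {0, i}" if e: "e \<in> edges G" for e
  proof -
    obtain i where i: "i \<in> {1..a}" "e \<in> D i" using e by (auto simp: G_def)
    then show ?thesis using label[OF i] by (intro exI[of _ i]) simp
  qed
  ultimately have "windmill t k (a * t + 1) G"
    unfolding windmill_def blade_labelling_def using G U_le
    by (intro conjI exI[of _ f]) (auto simp: G_def hub U_def, auto simp: V_def)
  moreover have "card (edges G) = a * k"
  proof -
    have "finite (D i)" if "i \<in> {1..a}" for i
      using D[OF that] finU finite_imp_finite_nsets by (metis finite.insertI finite_subset)
    moreover have "D i \<inter> D j = {}" if ij: "i \<in> {1..a}" "j \<in> {1..a}" "i \<noteq> j" for i j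
      using unique[OF ij(1) _ label[OF ij(2)]] ij(3) by auto
    ultimately have "card (\<Union>i\<in>{1..a}. D i) = (\<Sum>i\<in>{1..a}. card (D i))"
      by (intro card_UN_disjoint) simp_all
    then show ?thesis using D by (simp add: G_def)
  qed
  ultimately show thesis by (intro that[of G]) (auto simp: density_def G_def V_def)
qed

section \<open>Critical densities and the gap\<close>

lemma windmill_density_in_critical_densities:
  assumes t: "t > 0" "t * t \<le> 2 * k" and k: "k \<le> (t + 1) choose 2"
  shows "real (a * k) / real (a * t + 1) \<in> critical_densities"
proof -
  define \<A> where "\<A> = {G :: nat ugraph. windmill t k (a * t + 1) G}"
  obtain G :: "nat ugraph" where G: "G \<in> \<A>" "density G = real (a * k) / real (a * t + 1)"
    using windmill_exists[OF t(1) k, of a] by (auto simp: \<A>_def)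
  have "critical_density \<A> = real (a * k) / real (a * t + 1)"
    unfolding critical_density_def
  proof (rule cSup_eq_maximum)
    show "real (a * k) / real (a * t + 1) \<in> density ` \<A>" using G by force
  next
    fix d assume "d \<in> density ` \<A>"
    then show "d \<le> real (a * k) / real (a * t + 1)"
      using windmill_density_le[OF _ t] unfolding \<A>_def by blast
  qed
  moreover have "proper_class \<A>"
  proof -
    \<comment> \<open>Properness comes from the vertex bound: this edgeless graph has
      \<open>a * t + 2\<close> vertices.\<close>
    have "simple_graph ({..a * t + 1}, {})" "({..a * t + 1}, {}) \<notin> \<A>"
      by (auto simp: simple_graph_def \<A>_def windmill_def)
    moreover have "graph_class \<A>"
      unfolding graph_class_def \<A>_def using windmill_isomorphic windmill_def by blast
    ultimately show ?thesis using G unfolding proper_class_def by blast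
  qed
  moreover have "minor_closed \<A>"
    unfolding minor_closed_def \<A>_def using windmill_minor by blast
  ultimately show ?thesis
    unfolding critical_densities_def by (intro CollectI exI[of _ \<A>]) auto
qed

lemma critical_density_above:
  fixes x :: real
  assumes x: "x \<ge> 1"
  obtains \<beta> where "\<beta> \<in> critical_densities" "x < \<beta>" "\<beta> \<le> x + 1 / x\<^sup>2"
proof -
  \<comment> \<open>Both sides of the rounding matter: \<open>t \<le> 2 * x\<close> gives
    \<open>t * t \<le> 2 * k\<close>, while \<open>2 * x < t + 1\<close> ensures that
    \<open>k\<close> edges fit on \<open>t + 1\<close> vertices.\<close>
  define t where "t = nat \<lfloor>2 * x\<rfloor>"
  have t: "real t \<le> 2 * x" "2 * x < real t + 1" unfolding t_def using x by linarith+
  then have tx: "real t \<ge> x" "t > 0" using x by linarith+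
  \<comment> \<open>Floor plus one, not a ceiling: \<open>\<delta>\<close> must be positive even
    when \<open>x * t\<close> is an integer. The same holds for \<open>a\<close> and the strict
    inequality \<open>x < a * \<delta>\<close>.\<close>
  define k where "k = nat \<lfloor>x * real t\<rfloor> + 1"
  have "x * real t \<ge> 0" using x by simp
  then have k: "x * real t < real k" "real k \<le> x * real t + 1" unfolding k_def by linarith+
  define \<delta> where "\<delta> = real k - x * real t"
  have \<delta>: "0 < \<delta>" "\<delta> \<le> 1" using k by (auto simp: \<delta>_def)
  define a where "a = nat \<lfloor>x / \<delta>\<rfloor> + 1"
  have "x / \<delta> \<ge> 0" using x \<delta> by simp
  then have "x / \<delta> < real a" "real a \<le> x / \<delta> + 1" unfolding a_def by linarith+
  then have a: "x < real a * \<delta>" "real a * \<delta> \<le> x + \<delta>" using \<delta> by (auto simp: field_simps)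
  have "real a * \<delta> \<le> real a" using \<delta> by (simp add: mult_left_le)
  then have ax: "real a \<ge> x" using a by linarith
  define \<beta> where "\<beta> = real (a * k) / real (a * t + 1)"
  have "real t * real t \<le> 2 * (x * real t)" using mult_right_mono[OF t(1), of "real t"] by simp
  then have "real (t * t) \<le> real (2 * k)" using k by simp
  then have tt: "t * t \<le> 2 * k" by linarith
  have choose: "2 * ((t + 1) choose 2) = t * (t + 1)" using two_times_choose_two[of t] by simp
  \<comment> \<open>Since \<open>x * t\<close> is below the integer \<open>(t + 1) choose 2\<close>,
    the next integer \<open>k\<close> above \<open>x * t\<close> does not exceed it.\<close>
  have "2 * x * real t < (real t + 1) * real t" using t tx by (intro mult_strict_right_mono) auto
  also have "\<dots> = real (2 * ((t + 1) choose 2))" unfolding choose by (simp add: algebra_simps)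
  finally have "x * real t < real ((t + 1) choose 2)" by simp
  then have "k \<le> (t + 1) choose 2" unfolding k_def using \<open>x * real t \<ge> 0\<close> by linarith
  then have "\<beta> \<in> critical_densities"
    unfolding \<beta>_def using tx(2) tt by (intro windmill_density_in_critical_densities)
  moreover have excess: "\<beta> - x = (real a * \<delta> - x) / real (a * t + 1)"
    unfolding \<beta>_def \<delta>_def by (simp add: field_simps add_pos_nonneg add_nonneg_eq_0_iff)
  then have "x < \<beta>" using a(1) by (smt (verit) divide_pos_pos of_nat_0_less_iff zero_less_Suc Suc_eq_plus1)
  moreover have "\<beta> - x \<le> 1 / x\<^sup>2"
  proof -
    have "x * x \<le> real a * real t" using ax tx x by (intro mult_mono) auto
    then have "x\<^sup>2 \<le> real (a * t + 1)" by (simp add: power2_eq_square)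
    then show ?thesis unfolding excess using a(2) \<delta>(2) x by (intro frac_le) auto
  qed
  ultimately show thesis by (intro that[of \<beta>]) auto
qed

theorem theorem2:
  "density_gap \<in> O[at_top](\<lambda>x. x powr (-2))"
proof (rule bigoI[of _ 1])
  have "norm (density_gap x) \<le> 1 * norm (x powr (-2))" if x: "x \<ge> 1" for x
  proof -
    obtain \<beta> where \<beta>: "\<beta> \<in> critical_densities" "x < \<beta>" "\<beta> \<le> x + 1 / x\<^sup>2"
      using critical_density_above[OF x] .
    let ?S = "{\<beta> \<in> critical_densities. \<beta> > x}"
    \<comment> \<open>The witness makes \<open>?S\<close> nonempty and \<open>x\<close> bounds it
      below, so \<open>Inf\<close> is a genuine infimum and the gap is nonnegative.\<close>
    have "Inf ?S \<le> \<beta>" using \<beta> by (intro cInf_lower bdd_belowI[of _ x]) auto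
    moreover have "x \<le> Inf ?S" using \<beta> by (intro cInf_greatest) auto
    ultimately have "0 \<le> density_gap x" "density_gap x \<le> 1 / x\<^sup>2"
      using \<beta>(3) by (auto simp: density_gap_def)
    then show ?thesis using x by (simp add: powr_minus_divide)
  qed
  then show "\<forall>\<^sub>F x in at_top. norm (density_gap x) \<le> 1 * norm (x powr (-2))"
    by (rule eventually_at_top_linorderI)
qed

end
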